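(* Consider the stochastic mirror differential game with dynamics, for $i\in\mathcal N$, $$dX_{i,t}=U_{i,t}\,dt+\Sigma_i(Z_t)\,dW_{i,t},\qquad dE_{i,t}=V_{i,t}\,dt+\widetilde\Sigma_i(Z_t)\,d\widetilde W_{i,t},\qquad Z_t=(X_t,E_t),$$ and player costs $$J_i(z)=\mathbb E\Big[\int_0^T c_i(Z_t,U_t,V_t)\,dt+q_i(Z_T)\,\Big|\,Z_0=z\Big],$$ with stage cost $c_i$ and terminal cost $q_i$ as defined in the context. Let $(U^\star,V^\star)$ be a closed-loop equilibrium profile, with induced state trajectory $Z^\star_t=(X^\star_t,E^\star_t)$, whose Hamiltonian minimization over the controls $(u_i,v_i)$ is attained pointwise for every player relative to the value ansatz $V_i(z)=D_{\phi_i^*}(x_i+e_i,x_i^\star)$; that is, for every $i\in\mathcal N$ and along the trajectory $z=Z^\star_t$, $t\in[0,T]$, the pair $(U^\star_{i,t},V^\star_{i,t})$ minimizes over $(u_i,v_i)$ the control-dependent part of the Hamiltonian $$\langle \nabla_{x_i}V_i(z),u_i\rangle+\langle\nabla_{e_i}V_i(z),v_i\rangle+c_i(z,u_i,v_i).$$ Write $Y_t^\star=\nabla\phi^*(X_t^\star)$ and $\hat Y_t^\star=\nabla\phi^*(X_t^\star+E_t^\star)$. Then the equilibrium feedback laws satisfy, for every $i\in\mathcal N$, $$U_{i,t}^\star=-\nabla_{y_i}\psi_i(\hat Y_t^\star),\qquad V_{i,t}^\star=-\alpha E_{i,t}^\star-\alpha\eta\nabla_{y_i}\psi_i(Y_t^\star),$$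 and the induced equilibrium trajectory evolves according to $$dX_t^\star=-\Psi(\hat Y_t^\star)\,dt+\Sigma(Z_t^\star)\,dW_t,\qquad dE_t^\star=\big[-\alpha E_t^\star-\alpha\eta\Psi(Y_t^\star)\big]dt+\widetilde\Sigma(Z_t^\star)\,d\widetilde W_t.$$
   Context: Convex game: $\mathcal N$ is a finite player set; $\mathcal Y_i\subset\mathbb R^{n_i}$ is nonempty, closed and convex; $\mathcal Y=\prod_i\mathcal Y_i\subset\mathbb R^n$, $n=\sum_i n_i$; $\psi_i(y_i,y_{-i})$ is player $i$'s cost, twice continuously differentiable and convex in $y_i$ for fixed $y_{-i}$. The pseudo-gradient is $\Psi(y)=\operatorname{col}(\nabla_{y_i}\psi_i(y_i,y_{-i}))_{i\in\mathcal N}$. $y^\star\in\mathcal Y$ is a fixed Nash equilibrium, i.e. $\langle\Psi(y^\star),y-y^\star\rangle\ge0$ for all $y\in\mathcal Y$. Mirror geometry: each player has a Legendre potential $\phi_i:\mathcal Y_i\to\mathbb R$ (so $\operatorname{dom}\phi_i=\mathcal Y_i$) with Fenchel conjugate $\phi_i^*$; the dual space is $\mathcal X_i=\mathbb R^{n_i}$, and $\nabla\phi_i$ (defined on $\operatorname{int}(\operatorname{dom}\phi_i)$) is bijective onto $\mathcal X_i$ with inverse $\nabla\phi_i^*$. $\mathcal X=\prod_i\mathcal X_i$, $\nabla\phi^*(x)=\operatorname{col}(\nabla\phi_i^*(x_i))_i$, and similarly for $\nabla\phi$. $x_i^\star=\nabla\phi_i(y_i^\star)$. The Bregman divergence is $D_f(x,y)=f(x)-f(y)-\langle\nabla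 f(y),x-y\rangle$. Partial conjugate and Fenchel coupling: for $y_{-i}\in\mathcal Y_{-i}$, $\psi_i^*(u_i\mid y_{-i})=\sup_{y_i\in\mathcal Y_i}\{\langle u_i,y_i\rangle-\psi_i(y_i,y_{-i})\}$ and $\mathcal{FC}_{\psi_i(\cdot,y_{-i})}(y_i,w)=\psi_i(y_i,y_{-i})+\psi_i^*(w\mid y_{-i})-\langle w,y_i\rangle$. Differential game: states $z=(x,e)\in\mathcal X\times\mathcal X$, with $y=\nabla\phi^*(x)$, $\hat y=\nabla\phi^*(x+e)$. Controls of player $i$ are $u_i,v_i\in\mathcal X_i$. On a complete filtered probability space satisfying the usual conditions, $\{W_i,\widetilde W_i\}_{i\in\mathcal N}$ are mutually independent standard Brownian motions, all processes and controls are adapted, and $\Sigma_i,\widetilde\Sigma_i$ are measurable matrix-valued maps of the state; $\Sigma,\widetilde\Sigma$ are the block-diagonal concatenations and $W,\widetilde W$ the stacked Brownian motions. $\alpha,\eta>0$ are design parameters, $T>0$ is the horizon. The stage cost is $$c_i(z,u,v)=\psi_i(\hat y_i,\hat y_{-i})+\psi_i^*(-u_i\mid\hat y_{-i})+\langle u_i,y_i^\star\rangle+\alpha\eta\,\mathcal{FC}_{\psi_i(\cdot,y_{-i})}\Big(y_i,-\frac{v_i+\alpha e_i}{\alpha\eta}\Big)-\langle v_i,\hat y_i-y_i^\star\rangle$$ (it depends on the controls only through $(u_i,v_i)$, so one also writes $c_i(z,u_i,v_i)$), and the terminal cost is $q_i(Z_T)=D_{\phi_i^*}(X_{i,T}+E_{i,T},x_i^\star)$.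 A closed-loop equilibrium profile is a profile of state-feedback controls such that no player $i$ can decrease $J_i$ by unilaterally changing its own state-feedback controls $(U_i,V_i)$. *)

theory Defs
  imports "HOL-Probability.Probability"
begin

section \<open>Block structure of the joint space\<close>

text \<open>
  The joint space \<open>\<real>\<^sup>n\<close> is \<open>real ^ 'n\<close>. A map \<open>own\<close> assigns each coordinate to a
  player, so \<open>n\<^sub>i = card {k. own k = i}\<close> may differ from player to player. The
  \<open>n\<^sub>i\<close>-dimensional space of player \<open>i\<close> is represented by the vectors supported on the
  coordinates of \<open>i\<close>.
\<close>

definition block_space :: "('n::finite \<Rightarrow> 'i) \<Rightarrow> 'i \<Rightarrow> (real ^ 'n) set" where
  "block_space own i = {x. \<forall>k. own k \<noteq> i \<longrightarrow> x $ k = 0}"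

definition block :: "('n::finite \<Rightarrow> 'i) \<Rightarrow> 'i \<Rightarrow> real ^ 'n \<Rightarrow> real ^ 'n" where
  "block own i x = (\<chi> k. if own k = i then x $ k else 0)"

text \<open>\<open>block_upd own i y w\<close> is the profile \<open>(w, y\<^sub>-\<^sub>i)\<close>, and \<open>col own f\<close> stacks the blocks \<open>f i\<close>.\<close>

definition block_upd :: "('n::finite \<Rightarrow> 'i) \<Rightarrow> 'i \<Rightarrow> real ^ 'n \<Rightarrow> real ^ 'n \<Rightarrow> real ^ 'n" where
  "block_upd own i y w = (\<chi> k. if own k = i then w $ k else y $ k)"

definition col :: "('n::finite \<Rightarrow> 'i) \<Rightarrow> ('i \<Rightarrow> real ^ 'n) \<Rightarrow> real ^ 'n" where
  "col own f = (\<chi> k. f (own k) $ k)"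

definition block_interior :: "('n::finite \<Rightarrow> 'i) \<Rightarrow> 'i \<Rightarrow> (real ^ 'n) set \<Rightarrow> (real ^ 'n) set" where
  "block_interior own i S = (top_of_set (block_space own i)) interior_of S"

text \<open>
  Gradient in the space of player \<open>i\<close> of a function given on \<open>S \<subseteq> block_space own i\<close>. It is
  unique when \<open>S\<close> is convex with nonempty \<open>block_interior\<close>, and at interior points it is the
  ordinary gradient; at boundary points of \<open>S\<close> the derivative is relative to \<open>S\<close>.
\<close>

definition has_gradient_on ::
    "('n::finite \<Rightarrow> 'i) \<Rightarrow> 'i \<Rightarrow> (real ^ 'n) set \<Rightarrow> (real ^ 'n \<Rightarrow> real) \<Rightarrow> real ^ 'n \<Rightarrow> real ^ 'n \<Rightarrow> bool" where
  "has_gradient_on own i S f w g \<longleftrightarrow>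
     g \<in> block_space own i \<and> (f has_derivative (\<lambda>h. g \<bullet> h)) (at w within S)"

definition gradient_on ::
    "('n::finite \<Rightarrow> 'i) \<Rightarrow> 'i \<Rightarrow> (real ^ 'n) set \<Rightarrow> (real ^ 'n \<Rightarrow> real) \<Rightarrow> real ^ 'n \<Rightarrow> real ^ 'n" where
  "gradient_on own i S f w = (THE g. has_gradient_on own i S f w g)"

definition C2_on ::
    "('n::finite \<Rightarrow> 'i) \<Rightarrow> 'i \<Rightarrow> (real ^ 'n) set \<Rightarrow> (real ^ 'n \<Rightarrow> real) \<Rightarrow> bool" where
  "C2_on own i S f \<longleftrightarrow>
     (\<exists>g (H :: real ^ 'n \<Rightarrow> real ^ 'n ^ 'n).
        (\<forall>w\<in>S. has_gradient_on own i S f w (g w)) \<and>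
        (\<forall>w\<in>S. (g has_derivative (\<lambda>h. H w *v h)) (at w within S)) \<and>
        continuous_on S H)"


section \<open>Convex analysis\<close>

text \<open>
  A function \<open>f\<close> given on \<open>S\<close> is understood as \<open>\<infinity>\<close> outside \<open>S\<close>, so suprema over the whole
  space become suprema over \<open>S\<close>.
\<close>

definition fenchel_conj :: "'a::real_inner set \<Rightarrow> ('a \<Rightarrow> real) \<Rightarrow> 'a \<Rightarrow> ereal" where
  "fenchel_conj S f u = (SUP w\<in>S. ereal (u \<bullet> w - f w))"

definition fenchel_coupling :: "'a::real_inner set \<Rightarrow> ('a \<Rightarrow> real) \<Rightarrow> 'a \<Rightarrow> 'a \<Rightarrow> ereal" where
  "fenchel_coupling S f y w = ereal (f y) + fenchel_conj S f w - ereal (w \<bullet> y)"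

definition bregman ::
    "('n::finite \<Rightarrow> 'i) \<Rightarrow> 'i \<Rightarrow> (real ^ 'n) set \<Rightarrow> (real ^ 'n \<Rightarrow> real) \<Rightarrow> real ^ 'n \<Rightarrow> real ^ 'n \<Rightarrow> real" where
  "bregman own i S f x y = f x - f y - gradient_on own i S f y \<bullet> (x - y)"

text \<open>
  Legendre functions in the sense of Rockafellar: closed, convex, with nonempty interior of the
  domain, differentiable and strictly convex there, and with gradients blowing up at the
  boundary. \<open>S\<close> is the domain.
\<close>

definition legendre ::
    "('n::finite \<Rightarrow> 'i) \<Rightarrow> 'i \<Rightarrow> (real ^ 'n) set \<Rightarrow> (real ^ 'n \<Rightarrow> real) \<Rightarrow> bool" where
  "legendre own i S f \<longleftrightarrow>
     convex_on S f \<and> closed (epigraph S f) \<and> block_interior own i S \<noteq> {} \<and>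
     (\<forall>w\<in>block_interior own i S. \<exists>g. has_gradient_on own i S f w g) \<and>
     (\<forall>v\<in>block_interior own i S. \<forall>w\<in>block_interior own i S. \<forall>t\<in>{0<..<1}. v \<noteq> w \<longrightarrow>
        f ((1 - t) *\<^sub>R v + t *\<^sub>R w) < (1 - t) * f v + t * f w) \<and>
     (\<forall>w l. (\<forall>m. w m \<in> block_interior own i S) \<and> w \<longlonglongrightarrow> l \<and> l \<in> closure S - block_interior own i S \<longrightarrow>
        filterlim (\<lambda>m. norm (gradient_on own i S f (w m))) at_top sequentially)"


section \<open>The mirror game\<close>

type_synonym 'n state = "(real ^ 'n) \<times> (real ^ 'n)"

text \<open>
  Only the values of \<open>player_cost G i\<close> on the joint strategy set and those of \<open>potential G i\<close>
  on \<open>strategies G i\<close> matter. The fields \<open>diffusion\<close> and \<open>aux_diffusion\<close> are the block-diagonal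
  matrices \<open>\<Sigma>\<close> and \<open>\<Sigma>\<close>-tilde; \<open>noise_owner\<close> and \<open>aux_noise_owner\<close> assign the coordinates of the
  stacked Brownian motions to players.
\<close>

record ('i, 'n, 'w, 'v) mirror_game =
  owner :: "'n::finite \<Rightarrow> 'i"
  noise_owner :: "'w::finite \<Rightarrow> 'i"
  aux_noise_owner :: "'v::finite \<Rightarrow> 'i"
  strategies :: "'i \<Rightarrow> (real ^ 'n) set"
  player_cost :: "'i \<Rightarrow> real ^ 'n \<Rightarrow> real"
  potential :: "'i \<Rightarrow> real ^ 'n \<Rightarrow> real"
  nash :: "real ^ 'n"
  alpha :: real
  eta :: real
  horizon :: real
  diffusion :: "'n state \<Rightarrow> real ^ 'w ^ 'n"
  aux_diffusion :: "'n state \<Rightarrow> real ^ 'v ^ 'n"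

type_synonym 'n feedback = "real \<Rightarrow> 'n state \<Rightarrow> real ^ 'n"

definition joint_strategies ::
    "('i, 'n::finite, 'w::finite, 'v::finite) mirror_game \<Rightarrow> (real ^ 'n) set" where
  "joint_strategies G = {y. \<forall>i. block (owner G) i y \<in> strategies G i}"

definition own_cost ::
    "('i, 'n::finite, 'w::finite, 'v::finite) mirror_game \<Rightarrow> 'i \<Rightarrow> real ^ 'n \<Rightarrow> real ^ 'n \<Rightarrow> real" where
  "own_cost G i y w = player_cost G i (block_upd (owner G) i y w)"

definition partial_gradient ::
    "('i, 'n::finite, 'w::finite, 'v::finite) mirror_game \<Rightarrow> 'i \<Rightarrow> real ^ 'n \<Rightarrow> real ^ 'n" where
  "partial_gradient G i y =
     gradient_on (owner G) i (strategies G i) (own_cost G i y) (block (owner G) i y)"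

definition pseudo_gradient ::
    "('i, 'n::finite, 'w::finite, 'v::finite) mirror_game \<Rightarrow> real ^ 'n \<Rightarrow> real ^ 'n" where
  "pseudo_gradient G y = col (owner G) (\<lambda>i. partial_gradient G i y)"

definition grad_potential ::
    "('i, 'n::finite, 'w::finite, 'v::finite) mirror_game \<Rightarrow> 'i \<Rightarrow> real ^ 'n \<Rightarrow> real ^ 'n" where
  "grad_potential G i = gradient_on (owner G) i (strategies G i) (potential G i)"

text \<open>The conjugate of \<open>\<phi>\<^sub>i\<close> is finite everywhere because \<open>\<nabla>\<phi>\<^sub>i\<close> is onto.\<close>

definition potential_conj ::
    "('i, 'n::finite, 'w::finite, 'v::finite) mirror_game \<Rightarrow> 'i \<Rightarrow> real ^ 'n \<Rightarrow> real" where
  "potential_conj G i x = real_of_ereal (fenchel_conj (strategies G i) (potential G i) x)"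

definition grad_potential_conj ::
    "('i, 'n::finite, 'w::finite, 'v::finite) mirror_game \<Rightarrow> 'i \<Rightarrow> real ^ 'n \<Rightarrow> real ^ 'n" where
  "grad_potential_conj G i =
     gradient_on (owner G) i (block_space (owner G) i) (potential_conj G i)"

definition mirror_map ::
    "('i, 'n::finite, 'w::finite, 'v::finite) mirror_game \<Rightarrow> real ^ 'n \<Rightarrow> real ^ 'n" where
  "mirror_map G x = col (owner G) (\<lambda>i. grad_potential_conj G i (block (owner G) i x))"

definition nash_dual ::
    "('i, 'n::finite, 'w::finite, 'v::finite) mirror_game \<Rightarrow> 'i \<Rightarrow> real ^ 'n" where
  "nash_dual G i = grad_potential G i (block (owner G) i (nash G))"

definition convex_game ::
    "('i, 'n::finite, 'w::finite, 'v::finite) mirror_game \<Rightarrow> bool" where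
  "convex_game G \<longleftrightarrow>
     (\<forall>i. strategies G i \<subseteq> block_space (owner G) i \<and> strategies G i \<noteq> {} \<and>
          closed (strategies G i) \<and> convex (strategies G i)) \<and>
     (\<forall>i. \<forall>y\<in>joint_strategies G.
          C2_on (owner G) i (strategies G i) (own_cost G i y) \<and>
          convex_on (strategies G i) (own_cost G i y)) \<and>
     nash G \<in> joint_strategies G \<and>
     (\<forall>y\<in>joint_strategies G. pseudo_gradient G (nash G) \<bullet> (y - nash G) \<ge> 0)"

text \<open>
  The third clause says that \<open>\<nabla>\<phi>\<^sub>i\<^sup>*\<close> exists on the whole dual space and inverts \<open>\<nabla>\<phi>\<^sub>i\<close>. The last
  clause is what makes \<open>nash_dual\<close> meaningful, since \<open>\<nabla>\<phi>\<^sub>i\<close> lives on the interior only.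
\<close>

definition mirror_geometry ::
    "('i, 'n::finite, 'w::finite, 'v::finite) mirror_game \<Rightarrow> bool" where
  "mirror_geometry G \<longleftrightarrow>
     (\<forall>i. legendre (owner G) i (strategies G i) (potential G i) \<and>
          bij_betw (grad_potential G i) (block_interior (owner G) i (strategies G i))
            (block_space (owner G) i) \<and>
          (\<forall>y\<in>block_interior (owner G) i (strategies G i).
             has_gradient_on (owner G) i (block_space (owner G) i) (potential_conj G i)
               (grad_potential G i y) y) \<and>
          block (owner G) i (nash G) \<in> block_interior (owner G) i (strategies G i))"

definition game_parameters ::
    "('i, 'n::finite, 'w::finite, 'v::finite) mirror_game \<Rightarrow> bool" where
  "game_parameters G \<longleftrightarrow> alpha G > 0 \<and> eta G > 0 \<and> horizon G > 0 \<and>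
     diffusion G \<in> borel_measurable borel \<and> aux_diffusion G \<in> borel_measurable borel \<and>
     (\<forall>z k l. owner G k \<noteq> noise_owner G l \<longrightarrow> diffusion G z $ k $ l = 0) \<and>
     (\<forall>z k l. owner G k \<noteq> aux_noise_owner G l \<longrightarrow> aux_diffusion G z $ k $ l = 0)"


section \<open>Costs and Hamiltonian\<close>

text \<open>
  The partial conjugate may take the value \<open>\<infinity>\<close>, so costs are extended reals; \<open>-\<infinity>\<close> never
  occurs in the stage cost on the relevant states.
\<close>

definition partial_conj ::
    "('i, 'n::finite, 'w::finite, 'v::finite) mirror_game \<Rightarrow> 'i \<Rightarrow> real ^ 'n \<Rightarrow> real ^ 'n \<Rightarrow> ereal" where
  "partial_conj G i u y = fenchel_conj (strategies G i) (own_cost G i y) u"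

definition stage_cost ::
    "('i, 'n::finite, 'w::finite, 'v::finite) mirror_game \<Rightarrow> 'i \<Rightarrow> 'n state \<Rightarrow>
     real ^ 'n \<Rightarrow> real ^ 'n \<Rightarrow> ereal" where
  "stage_cost G i z u v =
     (let x = fst z; e = snd z; y = mirror_map G x; yh = mirror_map G (x + e);
          blk = block (owner G) i; a = alpha G; ae = alpha G * eta G
      in ereal (player_cost G i yh) + partial_conj G i (- blk u) yh
         + ereal (blk u \<bullet> blk (nash G))
         + ereal ae * fenchel_coupling (strategies G i) (own_cost G i y) (blk y)
             (- ((1 / ae) *\<^sub>R (blk v + a *\<^sub>R blk e)))
         - ereal (blk v \<bullet> (blk yh - blk (nash G))))"

definition terminal_cost ::
    "('i, 'n::finite, 'w::finite, 'v::finite) mirror_game \<Rightarrow> 'i \<Rightarrow> 'n state \<Rightarrow> real" where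
  "terminal_cost G i z =
     bregman (owner G) i (block_space (owner G) i) (potential_conj G i)
       (block (owner G) i (fst z) + block (owner G) i (snd z)) (nash_dual G i)"

definition value_ansatz ::
    "('i, 'n::finite, 'w::finite, 'v::finite) mirror_game \<Rightarrow> 'i \<Rightarrow> 'n state \<Rightarrow> real" where
  "value_ansatz G i z =
     bregman (owner G) i (block_space (owner G) i) (potential_conj G i)
       (block (owner G) i (fst z) + block (owner G) i (snd z)) (nash_dual G i)"

definition value_gradient_x ::
    "('i, 'n::finite, 'w::finite, 'v::finite) mirror_game \<Rightarrow> 'i \<Rightarrow> 'n state \<Rightarrow> real ^ 'n" where
  "value_gradient_x G i z =
     gradient_on (owner G) i (block_space (owner G) i)
       (\<lambda>w. value_ansatz G i (block_upd (owner G) i (fst z) w, snd z)) (block (owner G) i (fst z))"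

definition value_gradient_e ::
    "('i, 'n::finite, 'w::finite, 'v::finite) mirror_game \<Rightarrow> 'i \<Rightarrow> 'n state \<Rightarrow> real ^ 'n" where
  "value_gradient_e G i z =
     gradient_on (owner G) i (block_space (owner G) i)
       (\<lambda>w. value_ansatz G i (fst z, block_upd (owner G) i (snd z) w)) (block (owner G) i (snd z))"

definition control_hamiltonian ::
    "('i, 'n::finite, 'w::finite, 'v::finite) mirror_game \<Rightarrow> 'i \<Rightarrow> 'n state \<Rightarrow>
     real ^ 'n \<Rightarrow> real ^ 'n \<Rightarrow> ereal" where
  "control_hamiltonian G i z u v =
     ereal (value_gradient_x G i z \<bullet> u) + ereal (value_gradient_e G i z \<bullet> v) + stage_cost G i z u v"

definition minimizes_hamiltonian ::
    "('i, 'n::finite, 'w::finite, 'v::finite) mirror_game \<Rightarrow> 'i \<Rightarrow> 'n state \<Rightarrow>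
     real ^ 'n \<Rightarrow> real ^ 'n \<Rightarrow> bool" where
  "minimizes_hamiltonian G i z u v \<longleftrightarrow>
     u \<in> block_space (owner G) i \<and> v \<in> block_space (owner G) i \<and>
     (\<forall>u'\<in>block_space (owner G) i. \<forall>v'\<in>block_space (owner G) i.
        control_hamiltonian G i z u v \<le> control_hamiltonian G i z u' v')"


section \<open>Stochastic setting\<close>

definition usual_filtration :: "'p measure \<Rightarrow> (real \<Rightarrow> 'p measure) \<Rightarrow> bool" where
  "usual_filtration M F \<longleftrightarrow>
     prob_space M \<and> complete_measure M \<and>
     (\<forall>t\<ge>0. subalgebra M (F t)) \<and>
     (\<forall>s t. 0 \<le> s \<and> s \<le> t \<longrightarrow> sets (F s) \<subseteq> sets (F t)) \<and>
     null_sets M \<subseteq> sets (F 0) \<and>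
     (\<forall>t\<ge>0. sets (F t) = (\<Inter>s\<in>{t<..}. sets (F s)))"

text \<open>Block \<open>i\<close> of \<open>W\<close> is a standard Brownian motion with respect to the filtration.\<close>

definition standard_brownian_block ::
    "'p measure \<Rightarrow> (real \<Rightarrow> 'p measure) \<Rightarrow> ('w::finite \<Rightarrow> 'i) \<Rightarrow> 'i \<Rightarrow> (real \<Rightarrow> 'p \<Rightarrow> real ^ 'w) \<Rightarrow> bool" where
  "standard_brownian_block M F own i W \<longleftrightarrow>
     (AE \<omega> in M. block own i (W 0 \<omega>) = 0) \<and>
     (\<forall>t\<ge>0. (\<lambda>\<omega>. block own i (W t \<omega>)) \<in> borel_measurable (F t)) \<and>
     (\<forall>\<omega>\<in>space M. continuous_on {0..} (\<lambda>t. block own i (W t \<omega>))) \<and>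
     (\<forall>s t. 0 \<le> s \<and> s < t \<longrightarrow>
        (\<forall>l. own l = i \<longrightarrow>
           distributed M lborel (\<lambda>\<omega>. W t \<omega> $ l - W s \<omega> $ l) (normal_density 0 (sqrt (t - s)))) \<and>
        prob_space.indep_vars M (\<lambda>_. borel) (\<lambda>l \<omega>. W t \<omega> $ l - W s \<omega> $ l) {l. own l = i} \<and>
        prob_space.indep_set M (sets (F s))
          (sets (vimage_algebra (space M) (\<lambda>\<omega>. block own i (W t \<omega> - W s \<omega>)) borel)))"

text \<open>The events determined by the whole path of block \<open>i\<close> of \<open>W\<close>.\<close>

definition path_events ::
    "'p measure \<Rightarrow> ('w::finite \<Rightarrow> 'i) \<Rightarrow> (real \<Rightarrow> 'p \<Rightarrow> real ^ 'w) \<Rightarrow> 'i \<Rightarrow> 'p set set" where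
  "path_events M own W i =
     sets (vimage_algebra (space M) (\<lambda>\<omega>. \<lambda>t\<in>{0..}. block own i (W t \<omega>)) (PiM {0..} (\<lambda>_. borel)))"

definition stochastic_basis ::
    "('i, 'n::finite, 'w::finite, 'v::finite) mirror_game \<Rightarrow> 'p measure \<Rightarrow> (real \<Rightarrow> 'p measure) \<Rightarrow>
     (real \<Rightarrow> 'p \<Rightarrow> real ^ 'w) \<Rightarrow> (real \<Rightarrow> 'p \<Rightarrow> real ^ 'v) \<Rightarrow> bool" where
  "stochastic_basis G M F W W' \<longleftrightarrow>
     usual_filtration M F \<and>
     (\<forall>i. standard_brownian_block M F (noise_owner G) i W) \<and>
     (\<forall>i. standard_brownian_block M F (aux_noise_owner G) i W') \<and>
     prob_space.indep_sets M
       (case_sum (path_events M (noise_owner G) W) (path_events M (aux_noise_owner G) W'))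
       (UNIV :: ('i + 'i) set)"

definition continuous_adapted ::
    "'p measure \<Rightarrow> (real \<Rightarrow> 'p measure) \<Rightarrow> real \<Rightarrow> (real \<Rightarrow> 'p \<Rightarrow> real ^ 'n::finite) \<Rightarrow> bool" where
  "continuous_adapted M F T X \<longleftrightarrow>
     (\<forall>t\<in>{0..T}. X t \<in> borel_measurable (F t)) \<and>
     (\<forall>\<omega>\<in>space M. continuous_on {0..T} (\<lambda>t. X t \<omega>))"

definition progressive ::
    "(real \<Rightarrow> 'p measure) \<Rightarrow> real \<Rightarrow> (real \<Rightarrow> 'p \<Rightarrow> 'a::topological_space) \<Rightarrow> bool" where
  "progressive F T H \<longleftrightarrow>
     (\<forall>t\<in>{0..T}. (\<lambda>(s, \<omega>). H s \<omega>) \<in> borel_measurable (restrict_space borel {0..t} \<Otimes>\<^sub>M F t))"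

text \<open>
  The elementary process \<open>\<Sum>j<m. \<xi>\<^sub>j 1\<^bsub>(\<tau>\<^sub>j, \<tau>\<^sub>j\<^sub>+\<^sub>1]\<^esub>\<close> with bounded coefficients \<open>\<xi>\<^sub>j\<close> measurable at
  time \<open>\<tau>\<^sub>j\<close>.
\<close>

definition elementary_process ::
    "'p measure \<Rightarrow> (real \<Rightarrow> 'p measure) \<Rightarrow> nat \<Rightarrow> (nat \<Rightarrow> real) \<Rightarrow>
     (nat \<Rightarrow> 'p \<Rightarrow> real ^ 'w::finite ^ 'n::finite) \<Rightarrow> bool" where
  "elementary_process M F m \<tau> \<xi> \<longleftrightarrow>
     0 \<le> \<tau> 0 \<and> (\<forall>j<m. \<tau> j \<le> \<tau> (Suc j)) \<and>
     (\<forall>j<m. \<xi> j \<in> borel_measurable (F (\<tau> j)) \<and> (\<exists>C. \<forall>\<omega>\<in>space M. norm (\<xi> j \<omega>) \<le> C))"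

definition elementary_path ::
    "nat \<Rightarrow> (nat \<Rightarrow> real) \<Rightarrow> (nat \<Rightarrow> 'p \<Rightarrow> real ^ 'w::finite ^ 'n::finite) \<Rightarrow> real \<Rightarrow> 'p \<Rightarrow> real ^ 'w ^ 'n" where
  "elementary_path m \<tau> \<xi> s \<omega> = (\<Sum>j<m. indicator {\<tau> j<..\<tau> (Suc j)} s *\<^sub>R \<xi> j \<omega>)"

definition elementary_integral ::
    "nat \<Rightarrow> (nat \<Rightarrow> real) \<Rightarrow> (nat \<Rightarrow> 'p \<Rightarrow> real ^ 'w::finite ^ 'n::finite) \<Rightarrow>
     (real \<Rightarrow> 'p \<Rightarrow> real ^ 'w) \<Rightarrow> real \<Rightarrow> 'p \<Rightarrow> real ^ 'n" where
  "elementary_integral m \<tau> \<xi> W t \<omega> =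
     (\<Sum>j<m. \<xi> j \<omega> *v (W (min t (\<tau> (Suc j))) \<omega> - W (min t (\<tau> j)) \<omega>))"

text \<open>
  \<open>I\<close> is a continuous version on \<open>[0,T]\<close> of the Ito integral of the progressively measurable,
  pathwise square-integrable process \<open>H\<close>: elementary processes converge to \<open>H\<close> in \<open>L\<^sup>2([0,T])\<close> in
  probability, and their integrals converge to \<open>I\<close> in probability.
\<close>

definition has_ito_integral ::
    "'p measure \<Rightarrow> (real \<Rightarrow> 'p measure) \<Rightarrow> real \<Rightarrow> (real \<Rightarrow> 'p \<Rightarrow> real ^ 'w::finite) \<Rightarrow>
     (real \<Rightarrow> 'p \<Rightarrow> real ^ 'w ^ 'n::finite) \<Rightarrow> (real \<Rightarrow> 'p \<Rightarrow> real ^ 'n) \<Rightarrow> bool" where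
  "has_ito_integral M F T W H I \<longleftrightarrow>
     progressive F T H \<and>
     (AE \<omega> in M. (\<integral>\<^sup>+ s\<in>{0..T}. ennreal ((norm (H s \<omega>))\<^sup>2) \<partial>lborel) < \<infinity>) \<and>
     continuous_adapted M F T I \<and>
     (\<exists>m \<tau> \<xi>.
        (\<forall>r. elementary_process M F (m r) (\<tau> r) (\<xi> r)) \<and>
        (\<forall>\<epsilon>>0. (\<lambda>r::nat. measure M {\<omega>\<in>space M. ennreal \<epsilon> <
             (\<integral>\<^sup>+ s\<in>{0..T}. ennreal ((norm (elementary_path (m r) (\<tau> r) (\<xi> r) s \<omega> - H s \<omega>))\<^sup>2) \<partial>lborel)})
           \<longlonglongrightarrow> 0) \<and>
        (\<forall>t\<in>{0..T}. \<forall>\<epsilon>>0. (\<lambda>r. measure M {\<omega>\<in>space M.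
             \<epsilon> < norm (elementary_integral (m r) (\<tau> r) (\<xi> r) W t \<omega> - I t \<omega>)}) \<longlonglongrightarrow> 0))"

text \<open>\<open>dX = b dt + H dW\<close> on \<open>[0,T]\<close>, in integral form.\<close>

definition ito_equation ::
    "'p measure \<Rightarrow> (real \<Rightarrow> 'p measure) \<Rightarrow> real \<Rightarrow> (real \<Rightarrow> 'p \<Rightarrow> real ^ 'w::finite) \<Rightarrow>
     (real \<Rightarrow> 'p \<Rightarrow> real ^ 'n::finite) \<Rightarrow> (real \<Rightarrow> 'p \<Rightarrow> real ^ 'n) \<Rightarrow>
     (real \<Rightarrow> 'p \<Rightarrow> real ^ 'w ^ 'n) \<Rightarrow> bool" where
  "ito_equation M F T W X b H \<longleftrightarrow>
     continuous_adapted M F T X \<and>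
     (AE \<omega> in M. set_integrable lborel {0..T} (\<lambda>s. b s \<omega>)) \<and>
     (\<exists>I. has_ito_integral M F T W H I \<and>
        (AE \<omega> in M. \<forall>t\<in>{0..T}.
           X t \<omega> = X 0 \<omega> + set_lebesgue_integral lborel {0..t} (\<lambda>s. b s \<omega>) + I t \<omega>))"


section \<open>Closed-loop equilibria\<close>

text \<open>
  A profile \<open>(U, V)\<close> of state feedbacks prescribes the stacked controls \<open>U t z\<close>, \<open>V t z\<close>; the
  controls of player \<open>i\<close> are their \<open>i\<close>-th blocks.
\<close>

definition feedback_profile :: "('n::finite) feedback \<Rightarrow> bool" where
  "feedback_profile U \<longleftrightarrow> (\<lambda>(t, z). U t z) \<in> borel_measurable borel"

definition closed_loop_trajectory ::
    "('i, 'n::finite, 'w::finite, 'v::finite) mirror_game \<Rightarrow> 'p measure \<Rightarrow> (real \<Rightarrow> 'p measure) \<Rightarrow>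
     (real \<Rightarrow> 'p \<Rightarrow> real ^ 'w) \<Rightarrow> (real \<Rightarrow> 'p \<Rightarrow> real ^ 'v) \<Rightarrow> 'n feedback \<Rightarrow> 'n feedback \<Rightarrow> 'n state \<Rightarrow>
     (real \<Rightarrow> 'p \<Rightarrow> real ^ 'n) \<Rightarrow> (real \<Rightarrow> 'p \<Rightarrow> real ^ 'n) \<Rightarrow> bool" where
  "closed_loop_trajectory G M F W W' U V z X E \<longleftrightarrow>
     (AE \<omega> in M. (X 0 \<omega>, E 0 \<omega>) = z) \<and>
     ito_equation M F (horizon G) W X
       (\<lambda>t \<omega>. U t (X t \<omega>, E t \<omega>)) (\<lambda>t \<omega>. diffusion G (X t \<omega>, E t \<omega>)) \<and>
     ito_equation M F (horizon G) W' E
       (\<lambda>t \<omega>. V t (X t \<omega>, E t \<omega>)) (\<lambda>t \<omega>. aux_diffusion G (X t \<omega>, E t \<omega>))"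

text \<open>Integral of an extended real function of which not both parts have infinite integral.\<close>

definition quasi_integrable :: "'a measure \<Rightarrow> ('a \<Rightarrow> ereal) \<Rightarrow> bool" where
  "quasi_integrable N f \<longleftrightarrow> f \<in> borel_measurable N \<and>
     ((\<integral>\<^sup>+ x. e2ennreal (f x) \<partial>N) < \<infinity> \<or> (\<integral>\<^sup>+ x. e2ennreal (- f x) \<partial>N) < \<infinity>)"

definition ereal_integral :: "'a measure \<Rightarrow> ('a \<Rightarrow> ereal) \<Rightarrow> ereal" where
  "ereal_integral N f =
     enn2ereal (\<integral>\<^sup>+ x. e2ennreal (f x) \<partial>N) - enn2ereal (\<integral>\<^sup>+ x. e2ennreal (- f x) \<partial>N)"

definition running_cost ::
    "('i, 'n::finite, 'w::finite, 'v::finite) mirror_game \<Rightarrow> 'n feedback \<Rightarrow> 'n feedback \<Rightarrow>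
     (real \<Rightarrow> 'p \<Rightarrow> real ^ 'n) \<Rightarrow> (real \<Rightarrow> 'p \<Rightarrow> real ^ 'n) \<Rightarrow> 'i \<Rightarrow> 'p \<Rightarrow> real \<Rightarrow> ereal" where
  "running_cost G U V X E i \<omega> t =
     stage_cost G i (X t \<omega>, E t \<omega>) (U t (X t \<omega>, E t \<omega>)) (V t (X t \<omega>, E t \<omega>))"

definition pathwise_cost ::
    "('i, 'n::finite, 'w::finite, 'v::finite) mirror_game \<Rightarrow> 'n feedback \<Rightarrow> 'n feedback \<Rightarrow>
     (real \<Rightarrow> 'p \<Rightarrow> real ^ 'n) \<Rightarrow> (real \<Rightarrow> 'p \<Rightarrow> real ^ 'n) \<Rightarrow> 'i \<Rightarrow> 'p \<Rightarrow> ereal" where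
  "pathwise_cost G U V X E i \<omega> =
     ereal_integral (restrict_space lborel {0..horizon G}) (running_cost G U V X E i \<omega>)
     + ereal (terminal_cost G i (X (horizon G) \<omega>, E (horizon G) \<omega>))"

definition total_cost ::
    "('i, 'n::finite, 'w::finite, 'v::finite) mirror_game \<Rightarrow> 'p measure \<Rightarrow> 'n feedback \<Rightarrow> 'n feedback \<Rightarrow>
     (real \<Rightarrow> 'p \<Rightarrow> real ^ 'n) \<Rightarrow> (real \<Rightarrow> 'p \<Rightarrow> real ^ 'n) \<Rightarrow> 'i \<Rightarrow> ereal" where
  "total_cost G M U V X E i = ereal_integral M (pathwise_cost G U V X E i)"

definition cost_defined ::
    "('i, 'n::finite, 'w::finite, 'v::finite) mirror_game \<Rightarrow> 'p measure \<Rightarrow> 'n feedback \<Rightarrow> 'n feedback \<Rightarrow>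
     (real \<Rightarrow> 'p \<Rightarrow> real ^ 'n) \<Rightarrow> (real \<Rightarrow> 'p \<Rightarrow> real ^ 'n) \<Rightarrow> 'i \<Rightarrow> bool" where
  "cost_defined G M U V X E i \<longleftrightarrow>
     (AE \<omega> in M. quasi_integrable (restrict_space lborel {0..horizon G}) (running_cost G U V X E i \<omega>)) \<and>
     quasi_integrable M (pathwise_cost G U V X E i)"

definition unilateral_deviation ::
    "('n::finite \<Rightarrow> 'i) \<Rightarrow> 'i \<Rightarrow> 'n feedback \<Rightarrow> 'n feedback \<Rightarrow> bool" where
  "unilateral_deviation own i U U' \<longleftrightarrow>
     feedback_profile U' \<and> (\<forall>t z k. own k \<noteq> i \<longrightarrow> U' t z $ k = U t z $ k)"

text \<open>
  The state equation need not have unique solutions, so costs are attached to trajectories;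
  deviations are compared from the same initial state \<open>z\<close>, whenever their cost is defined.
\<close>

definition closed_loop_equilibrium ::
    "('i, 'n::finite, 'w::finite, 'v::finite) mirror_game \<Rightarrow> 'p measure \<Rightarrow> (real \<Rightarrow> 'p measure) \<Rightarrow>
     (real \<Rightarrow> 'p \<Rightarrow> real ^ 'w) \<Rightarrow> (real \<Rightarrow> 'p \<Rightarrow> real ^ 'v) \<Rightarrow> 'n feedback \<Rightarrow> 'n feedback \<Rightarrow> bool" where
  "closed_loop_equilibrium G M F W W' U V \<longleftrightarrow>
     feedback_profile U \<and> feedback_profile V \<and>
     (\<forall>z X E i. closed_loop_trajectory G M F W W' U V z X E \<longrightarrow>
        cost_defined G M U V X E i \<and>
        (\<forall>U' V' X' E'.
           unilateral_deviation (owner G) i U U' \<and> unilateral_deviation (owner G) i V V' \<and>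
           closed_loop_trajectory G M F W W' U' V' z X' E' \<and> cost_defined G M U' V' X' E' i \<longrightarrow>
           \<not> total_cost G M U' V' X' E' i < total_cost G M U V X E i))"

end

theory Submission
  imports Defs
begin

text \<open>
  Write \<open>w = \<nabla>\<phi>\<^sup>*(x + e)\<close> for the point \<open>y\<close>-hat and \<open>y'\<close> for the Nash equilibrium. By the inverse
  relation between \<open>\<nabla>\<phi>\<^sub>i\<close> and \<open>\<nabla>\<phi>\<^sub>i\<^sup>*\<close>, the ansatz has both partial gradients equal to
  \<open>w\<^sub>i - y'\<^sub>i\<close>, so the terms with \<open>y'\<^sub>i\<close> cancel and the control-dependent Hamiltonian is a sum of two
  Fenchel couplings, \<open>FC(w\<^sub>i, -u\<^sub>i) + \<alpha>\<eta> FC(y\<^sub>i, -(v\<^sub>i + \<alpha>e\<^sub>i)/\<alpha>\<eta>)\<close>. Both are nonnegative, and by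
  convexity both vanish when the dual arguments are the partial gradients; hence they vanish at every
  minimizer. As \<open>y\<^sub>i\<close> and \<open>w\<^sub>i\<close> are interior, a vanishing coupling determines its dual argument as the
  partial gradient. The drifts then agree for all times on almost every path.
\<close>

section \<open>Blocks and gradients\<close>

lemma block_in_block_space [simp]: "block own i x \<in> block_space own i"
  by (simp add: block_def block_space_def)

lemma block_of_block_space: "x \<in> block_space own i \<Longrightarrow> block own i x = x"
  by (auto simp: block_def block_space_def vec_eq_iff)

lemma block_add: "block own i (x + y) = block own i x + block own i y"
  by (simp add: block_def vec_eq_iff)

lemma block_upd_block [simp]: "block_upd own i y (block own i y) = y"
  by (simp add: block_def block_upd_def vec_eq_iff)

lemma block_block_upd: "w \<in> block_space own i \<Longrightarrow> block own i (block_upd own i x w) = w"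
  by (auto simp: block_def block_upd_def block_space_def vec_eq_iff)

lemma block_col: "f i \<in> block_space own i \<Longrightarrow> block own i (col own f) = f i"
  by (auto simp: block_def col_def block_space_def vec_eq_iff)

lemma subspace_block_space: "subspace (block_space own i)"
  by (simp add: subspace_def block_space_def)

text \<open>The interior is taken relative to the block space, so every dual point is interior.
  Uniqueness of gradients therefore applies to \<open>potential_conj\<close> everywhere.\<close>

lemma block_interior_block_space [simp]:
  "block_interior own i (block_space own i) = block_space own i"
  by (metis block_interior_def interior_of_topspace topspace_euclidean_subtopology)

lemma block_interiorD: "x \<in> block_interior own i S \<Longrightarrow> x \<in> S"
  unfolding block_interior_def by (rule subsetD[OF interior_of_subset])

text \<open>An interior point can be moved in both directions along \<open>h\<close>. This two-sided
  room turns first-order conditions into equations instead of inequalities.\<close>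

lemma block_interior_line:
  assumes y: "y \<in> block_interior own i S" and h: "h \<in> block_space own i"
  shows "\<exists>d>0. \<forall>t. \<bar>t\<bar> < d \<longrightarrow> y + t *\<^sub>R h \<in> S"
proof -
  obtain T where T: "openin (top_of_set (block_space own i)) T" "y \<in> T" "T \<subseteq> S"
    using y by (auto simp: block_interior_def interior_of_def)
  then obtain e where e: "e > 0" "ball y e \<inter> block_space own i \<subseteq> T"
    by (auto simp: openin_contains_ball)
  have yB: "y \<in> block_space own i"
    using T by (auto dest: openin_imp_subset)
  \<comment> \<open>The summand 1 keeps the denominator positive when \<open>h = 0\<close>.\<close>
  have "y + t *\<^sub>R h \<in> S" if t: "\<bar>t\<bar> < e / (norm h + 1)" for t
  proof -
    have "\<bar>t\<bar> * norm h \<le> \<bar>t\<bar> * (norm h + 1)"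
      by (simp add: mult_left_mono)
    also have "\<dots> < e"
      using t by (simp add: pos_less_divide_eq add_nonneg_pos)
    finally have "y + t *\<^sub>R h \<in> ball y e"
      by (simp add: dist_norm)
    moreover have "y + t *\<^sub>R h \<in> block_space own i"
      by (intro subspace_add subspace_scale subspace_block_space yB h)
    ultimately show ?thesis
      using e T by blast
  qed
  moreover have "e / (norm h + 1) > 0"
    using e by (simp add: add_nonneg_pos)
  ultimately show ?thesis by blast
qed

section \<open>Derivatives along lines and first-order conditions\<close>

lemma has_derivative_in_compose_subset:
  assumes "(g has_derivative g') (at (f x) within T)" and "f ` S \<subseteq> T"
    and "(f has_derivative f') (at x within S)"
  shows "((\<lambda>x. g (f x)) has_derivative (\<lambda>h. g' (f' h))) (at x within S)"
  using assms by (blast intro: has_derivative_in_compose has_derivative_subset)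

text \<open>The parameter set \<open>A\<close> is left open for two uses: a symmetric open interval
  at interior points, and \<open>{0..1}\<close> for segments in a convex set.\<close>

lemma has_derivative_within_line:
  assumes f: "(f has_derivative (\<lambda>h. g \<bullet> h)) (at y within S)"
    and "\<And>t. t \<in> A \<Longrightarrow> y + t *\<^sub>R h \<in> S"
  shows "((\<lambda>t. f (y + t *\<^sub>R h)) has_real_derivative (g \<bullet> h)) (at 0 within A)"
proof -
  have "((\<lambda>t. f (y + t *\<^sub>R h)) has_derivative (\<lambda>t. g \<bullet> (t *\<^sub>R h))) (at 0 within A)"
  proof (rule has_derivative_in_compose_subset[where f = "\<lambda>t. y + t *\<^sub>R h" and g = f])
    show "(f has_derivative (\<lambda>h. g \<bullet> h)) (at (y + 0 *\<^sub>R h) within S)"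
      using f by simp
  qed (use assms(2) in \<open>auto intro!: derivative_eq_intros\<close>)
  then show ?thesis
    by (simp add: has_field_derivative_def mult_commute_abs)
qed

text \<open>Fermat's rule for \<open>f\<close> minus the linear function of \<open>u\<close>, along
  the direction \<open>g - u\<close>. The derivative there is the squared norm of
  \<open>g - u\<close>, and it must vanish.\<close>

lemma interior_minimum_gradient:
  assumes y: "y \<in> block_interior own i S"
    and g: "has_gradient_on own i S f y g"
    and u: "u \<in> block_space own i"
    and le: "\<And>w. w \<in> S \<Longrightarrow> f y - u \<bullet> y \<le> f w - u \<bullet> w"
  shows "u = g"
proof -
  define h where "h = g - u"
  have h: "h \<in> block_space own i"
    using g u by (auto simp: h_def has_gradient_on_def intro!: subspace_diff subspace_block_space)
  obtain d where d: "d > 0" "\<And>t. \<bar>t\<bar> < d \<Longrightarrow> y + t *\<^sub>R h \<in> S"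
    using block_interior_line[OF y h] by blast
  have "((\<lambda>t. f (y + t *\<^sub>R h)) has_real_derivative (g \<bullet> h)) (at 0 within {-d<..<d})"
    using g d by (intro has_derivative_within_line) (auto simp: has_gradient_on_def abs_less_iff)
  then have "((\<lambda>t. f (y + t *\<^sub>R h)) has_real_derivative (g \<bullet> h)) (at 0)"
    using d(1) by (subst (asm) at_within_open) auto
  then have "((\<lambda>t. f (y + t *\<^sub>R h) - (u \<bullet> y + t * (u \<bullet> h))) has_real_derivative (g \<bullet> h - u \<bullet> h)) (at 0)"
    by (auto intro!: derivative_eq_intros)
  then have "g \<bullet> h - u \<bullet> h = 0"
  proof (rule DERIV_local_min[OF _ d(1)], intro allI impI)
    fix t :: real
    assume "\<bar>0 - t\<bar> < d"
    then show "f (y + 0 *\<^sub>R h) - (u \<bullet> y + 0 * (u \<bullet> h)) \<le> f (y + t *\<^sub>R h) - (u \<bullet> y + t * (u \<bullet> h))"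
      using le[OF d(2)[of t]] by (simp add: inner_add_right)
  qed
  then have "h \<bullet> h = 0"
    by (simp add: h_def inner_diff_left)
  then show ?thesis
    by (simp add: h_def)
qed

text \<open>The difference of two gradients is a gradient of the zero function. Every point
  minimizes that function, so Fermat's rule with \<open>u = 0\<close> forces the difference to be
  0.\<close>

lemma has_gradient_on_unique:
  assumes y: "y \<in> block_interior own i S"
    and g: "has_gradient_on own i S f y g" and g': "has_gradient_on own i S f y g'"
  shows "g = g'"
proof -
  have "((\<lambda>w. f w - f w) has_derivative (\<lambda>h. g \<bullet> h - g' \<bullet> h)) (at y within S)"
    using g g' unfolding has_gradient_on_def by (blast intro: has_derivative_diff)
  moreover have "g - g' \<in> block_space own i"
    using g g' by (auto simp: has_gradient_on_def intro!: subspace_diff subspace_block_space)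
  ultimately have "has_gradient_on own i S (\<lambda>w. 0) y (g - g')"
    by (simp add: has_gradient_on_def inner_diff_left)
  from interior_minimum_gradient[OF y this, of 0] show ?thesis
    by (simp add: subspace_0 subspace_block_space)
qed

lemma gradient_on_eqI:
  "y \<in> block_interior own i S \<Longrightarrow> has_gradient_on own i S f y g \<Longrightarrow> gradient_on own i S f y = g"
  unfolding gradient_on_def by (rule the_equality) (auto intro: has_gradient_on_unique)

text \<open>By convexity, the difference quotients on the segment from \<open>y\<close> to
  \<open>w\<close> are at most \<open>f w - f y\<close>, and they tend to
  \<open>g \<bullet> (w - y)\<close>. The limit is one-sided, so \<open>y\<close> may lie on the
  boundary of \<open>S\<close>.\<close>

lemma convex_on_gradient_inequality:
  assumes f: "convex_on S f" and g: "has_gradient_on own i S f y g"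
    and "y \<in> S" "w \<in> S"
  shows "f y + g \<bullet> (w - y) \<le> f w"
proof -
  have comb: "y + t *\<^sub>R (w - y) = (1 - t) *\<^sub>R y + t *\<^sub>R w" for t
    by (simp add: algebra_simps)
  have mem: "y + t *\<^sub>R (w - y) \<in> S" if "t \<in> {0..1}" for t
    using that assms convex_on_imp_convex[OF f] unfolding comb by (intro convexD) auto
  have "((\<lambda>t. f (y + t *\<^sub>R (w - y))) has_real_derivative (g \<bullet> (w - y))) (at 0 within {0..1})"
    using g mem by (intro has_derivative_within_line) (auto simp: has_gradient_on_def)
  then have "((\<lambda>t. (f (y + t *\<^sub>R (w - y)) - f y) / t) \<longlongrightarrow> g \<bullet> (w - y)) (at 0 within {0..1})"
    by (simp add: has_field_derivative_iff)
  moreover have "\<forall>\<^sub>F t in at 0 within {0..1}. (f (y + t *\<^sub>R (w - y)) - f y) / t \<le> f w - f y"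
    unfolding eventually_at_filter
  proof (intro always_eventually allI impI)
    fix t :: real
    assume t: "t \<noteq> 0" "t \<in> {0..1}"
    have "f (y + t *\<^sub>R (w - y)) \<le> (1 - t) * f y + t * f w"
      using t assms unfolding comb by (intro convex_onD[OF f]) auto
    then have "f (y + t *\<^sub>R (w - y)) - f y \<le> (f w - f y) * t"
      by (simp add: algebra_simps)
    then show "(f (y + t *\<^sub>R (w - y)) - f y) / t \<le> f w - f y"
      using t by (simp add: pos_divide_le_eq)
  qed
  moreover have "at 0 within {0..1::real} \<noteq> bot"
    by (simp add: trivial_limit_within islimpt_Icc)
  ultimately have "g \<bullet> (w - y) \<le> f w - f y"
    by (intro tendsto_upperbound)
  then show ?thesis by simp
qed

section \<open>Fenchel couplings\<close>

lemma fenchel_conj_ge: "w \<in> S \<Longrightarrow> ereal (u \<bullet> w - f w) \<le> fenchel_conj S f u"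
  unfolding fenchel_conj_def by (rule SUP_upper)

lemma fenchel_conj_neq_MInf: "w \<in> S \<Longrightarrow> fenchel_conj S f u \<noteq> -\<infinity>"
  using fenchel_conj_ge[of w S u f] by auto

text \<open>This is the Fenchel-Young inequality: \<open>y\<close> itself competes in the supremum.
  The value \<infinity> of the conjugate is allowed.\<close>

lemma fenchel_coupling_nonneg:
  assumes "y \<in> S" shows "0 \<le> fenchel_coupling S f y u"
  using fenchel_conj_ge[OF assms, of u f] fenchel_conj_neq_MInf[OF assms, of f u]
  by (cases "fenchel_conj S f u") (auto simp: fenchel_coupling_def)

text \<open>The right-hand side is the minimality condition required by
  \<open>interior_minimum_gradient\<close>. If the conjugate is \<infinity>, both sides are
  false.\<close>

lemma fenchel_coupling_le_0_iff:
  assumes "y \<in> S"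
  shows "fenchel_coupling S f y u \<le> 0 \<longleftrightarrow> (\<forall>w\<in>S. f y - u \<bullet> y \<le> f w - u \<bullet> w)"
proof -
  have "fenchel_coupling S f y u \<le> 0 \<longleftrightarrow> fenchel_conj S f u \<le> ereal (u \<bullet> y - f y)"
    using fenchel_conj_neq_MInf[OF assms, of f u]
    by (cases "fenchel_conj S f u") (auto simp: fenchel_coupling_def)
  also have "\<dots> \<longleftrightarrow> (\<forall>w\<in>S. f y - u \<bullet> y \<le> f w - u \<bullet> w)"
    by (auto simp: fenchel_conj_def SUP_le_iff)
  finally show ?thesis .
qed

text \<open>Equality case of Fenchel-Young: by the gradient inequality, \<open>y\<close> attains the
  supremum in the conjugate at \<open>g\<close>.\<close>

lemma fenchel_coupling_gradient:
  assumes "convex_on S f" "has_gradient_on own i S f y g" "y \<in> S"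
  shows "fenchel_coupling S f y g = 0"
proof (rule antisym)
  show "fenchel_coupling S f y g \<le> 0"
    using convex_on_gradient_inequality[OF assms(1,2,3)] assms(3)
    by (fastforce simp: fenchel_coupling_le_0_iff inner_diff_right)
qed (simp add: fenchel_coupling_nonneg assms)

section \<open>The Hamiltonian\<close>

text \<open>Surjectivity writes \<open>p\<close> as the gradient of the potential at an interior
  point \<open>y\<close>. The geometry makes \<open>y\<close> a gradient of the conjugate at
  \<open>p\<close>, and uniqueness identifies it with \<open>grad_potential_conj G i p\<close>.
  Interior values matter later, where they make the cost gradients unique.\<close>

lemma has_gradient_potential_conj:
  assumes "mirror_geometry G" "p \<in> block_space (owner G) i"
  shows "has_gradient_on (owner G) i (block_space (owner G) i) (potential_conj G i) p
           (grad_potential_conj G i p)"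
    and "grad_potential_conj G i p \<in> block_interior (owner G) i (strategies G i)"
proof -
  obtain y where y: "y \<in> block_interior (owner G) i (strategies G i)" "p = grad_potential G i y"
    using assms unfolding mirror_geometry_def bij_betw_def by blast
  then have g: "has_gradient_on (owner G) i (block_space (owner G) i) (potential_conj G i) p y"
    using assms unfolding mirror_geometry_def by blast
  then have "grad_potential_conj G i p = y"
    using assms unfolding grad_potential_conj_def by (intro gradient_on_eqI) auto
  with g y show "has_gradient_on (owner G) i (block_space (owner G) i) (potential_conj G i) p
           (grad_potential_conj G i p)"
    and "grad_potential_conj G i p \<in> block_interior (owner G) i (strategies G i)"
    by auto
qed

lemma block_mirror_map:
  assumes "mirror_geometry G"
  shows "block (owner G) i (mirror_map G x) = grad_potential_conj G i (block (owner G) i x)"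
  unfolding mirror_map_def
  using has_gradient_potential_conj(1)[OF assms block_in_block_space, of i x]
  by (subst block_col) (auto simp: has_gradient_on_def)

lemma block_mirror_map_interior:
  assumes "mirror_geometry G"
  shows "block (owner G) i (mirror_map G x) \<in> block_interior (owner G) i (strategies G i)"
  by (simp add: block_mirror_map[OF assms] has_gradient_potential_conj(2)[OF assms])

lemma mirror_map_in_joint_strategies:
  assumes "mirror_geometry G"
  shows "mirror_map G x \<in> joint_strategies G"
  by (simp add: joint_strategies_def block_interiorD[OF block_mirror_map_interior[OF assms]])

text \<open>The Nash block is interior, so the same inversion applies to it. This evaluates the
  linear term of the Bregman divergence in the ansatz.\<close>

lemma grad_potential_conj_nash_dual:
  assumes "mirror_geometry G"
  shows "nash_dual G i \<in> block_space (owner G) i"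
    and "gradient_on (owner G) i (block_space (owner G) i) (potential_conj G i) (nash_dual G i)
           = block (owner G) i (nash G)"
proof -
  have n: "block (owner G) i (nash G) \<in> block_interior (owner G) i (strategies G i)"
    using assms unfolding mirror_geometry_def by blast
  then show B: "nash_dual G i \<in> block_space (owner G) i"
    using assms unfolding mirror_geometry_def bij_betw_def nash_dual_def by blast
  have "has_gradient_on (owner G) i (block_space (owner G) i) (potential_conj G i)
          (nash_dual G i) (block (owner G) i (nash G))"
    using assms n unfolding mirror_geometry_def nash_dual_def by blast
  with B show "gradient_on (owner G) i (block_space (owner G) i) (potential_conj G i) (nash_dual G i)
           = block (owner G) i (nash G)"
    by (intro gradient_on_eqI) auto
qed

text \<open>A single computation serves both partial gradients, with \<open>q\<close> the block held
  fixed. The function \<open>f\<close> is prescribed on the block space only, because the ansatz is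
  written with \<open>block_upd\<close> and reduces to a function of \<open>w + q\<close> just for
  \<open>w\<close> in that space.\<close>

lemma gradient_bregman_potential_conj:
  assumes mg: "mirror_geometry G"
    and p: "p \<in> block_space (owner G) i" and q: "q \<in> block_space (owner G) i"
    and f: "\<And>w. w \<in> block_space (owner G) i \<Longrightarrow>
      f w = bregman (owner G) i (block_space (owner G) i) (potential_conj G i) (w + q) (nash_dual G i)"
  shows "gradient_on (owner G) i (block_space (owner G) i) f p
           = grad_potential_conj G i (p + q) - block (owner G) i (nash G)"
proof (rule gradient_on_eqI)
  let ?B = "block_space (owner G) i" and ?n = "block (owner G) i (nash G)"
  have pq: "p + q \<in> ?B"
    by (intro subspace_add subspace_block_space p q)
  note g = has_gradient_potential_conj(1)[OF mg pq]
  have "((\<lambda>w. potential_conj G i (w + q)) has_derivative (\<lambda>h. grad_potential_conj G i (p + q) \<bullet> h))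
          (at p within ?B)"
  proof (rule has_derivative_in_compose_subset[where f = "\<lambda>w. w + q" and f' = "\<lambda>h. h"])
    show "(potential_conj G i has_derivative (\<lambda>h. grad_potential_conj G i (p + q) \<bullet> h))
            (at (p + q) within ?B)"
      using g by (simp add: has_gradient_on_def)
    show "(\<lambda>w. w + q) ` ?B \<subseteq> ?B"
      using q by (auto intro: subspace_add subspace_block_space)
  qed (use p in \<open>auto intro!: derivative_eq_intros\<close>)
  then have "((\<lambda>w. potential_conj G i (w + q) - potential_conj G i (nash_dual G i)
                  - ?n \<bullet> (w + q - nash_dual G i))
              has_derivative (\<lambda>h. grad_potential_conj G i (p + q) \<bullet> h - ?n \<bullet> h)) (at p within ?B)"
    by (auto intro!: derivative_eq_intros)
  then have "(f has_derivative (\<lambda>h. grad_potential_conj G i (p + q) \<bullet> h - ?n \<bullet> h)) (at p within ?B)"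
    by (rule has_derivative_transform[OF p, rotated])
      (simp add: f bregman_def grad_potential_conj_nash_dual[OF mg])
  moreover have "grad_potential_conj G i (p + q) - ?n \<in> ?B"
    using g by (auto simp: has_gradient_on_def intro!: subspace_diff subspace_block_space)
  ultimately show "has_gradient_on (owner G) i ?B f p (grad_potential_conj G i (p + q) - ?n)"
    by (simp add: has_gradient_on_def inner_diff_left)
qed (simp add: p)

text \<open>The two gradients agree because the ansatz depends on the sum of the two blocks alone.
  For the second one the sum is commuted so that the varying block comes first.\<close>

lemma value_gradients:
  assumes mg: "mirror_geometry G"
  shows "value_gradient_x G i (x, e)
           = block (owner G) i (mirror_map G (x + e)) - block (owner G) i (nash G)" (is ?thesis1)
    and "value_gradient_e G i (x, e)
           = block (owner G) i (mirror_map G (x + e)) - block (owner G) i (nash G)" (is ?thesis2)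
proof -
  show ?thesis1
    unfolding value_gradient_x_def block_mirror_map[OF mg] block_add fst_conv snd_conv
    by (rule gradient_bregman_potential_conj[OF mg]) (auto simp: value_ansatz_def block_block_upd)
  show ?thesis2
    unfolding value_gradient_e_def block_mirror_map[OF mg] block_add fst_conv snd_conv
    by (subst add.commute, rule gradient_bregman_potential_conj[OF mg])
      (auto simp: value_ansatz_def block_block_upd add.commute)
qed

section \<open>Decomposition and minimization of the Hamiltonian\<close>

text \<open>The term in \<open>v\<close> from the ansatz cancels the last term of the stage cost.
  The term in \<open>u\<close>, added to the Nash term, leaves the pairing of \<open>u\<close> with
  the block of \<open>mirror_map G (x + e)\<close>, which completes the first coupling.\<close>

lemma control_hamiltonian_eq:
  assumes mg: "mirror_geometry G" and gp: "game_parameters G"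
    and u: "u \<in> block_space (owner G) i" and v: "v \<in> block_space (owner G) i"
  shows "control_hamiltonian G i (x, e) u v =
    fenchel_coupling (strategies G i) (own_cost G i (mirror_map G (x + e)))
      (block (owner G) i (mirror_map G (x + e))) (- u)
    + ereal (alpha G * eta G) *
      fenchel_coupling (strategies G i) (own_cost G i (mirror_map G x))
        (block (owner G) i (mirror_map G x))
        (- ((1 / (alpha G * eta G)) *\<^sub>R (v + alpha G *\<^sub>R block (owner G) i e)))"
proof -
  \<comment> \<open>Rearranging extended reals needs care with infinite values. Here
    \<open>C\<close> is the partial conjugate and \<open>K\<close> the scaled second coupling;
    neither is \<open>-\<infinity>\<close>, so no difference of infinities arises.\<close>
  have cancel: "ereal a + ereal b + (ereal p + C + ereal c + K - ereal d) = ereal p + C - ereal q + K"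
    if "0 \<le> K" "C \<noteq> -\<infinity>" "a + b + c - d = - q" for C K a b c d p q
    using that by (cases C; cases K) auto
  have ae: "alpha G * eta G > 0"
    using gp by (simp add: game_parameters_def)
  have inS: "block (owner G) i (mirror_map G y) \<in> strategies G i" for y
    by (rule block_interiorD[OF block_mirror_map_interior[OF mg]])
  show ?thesis
    unfolding control_hamiltonian_def stage_cost_def Let_def fst_conv snd_conv
      value_gradients[OF mg] block_of_block_space[OF u] block_of_block_space[OF v] partial_conj_def
      fenchel_coupling_def[of _ _ _ "- u"] own_cost_def[of G i _ "block _ _ _"] block_upd_block
  proof (rule cancel)
    show "0 \<le> ereal (alpha G * eta G) *
      fenchel_coupling (strategies G i) (own_cost G i (mirror_map G x)) (block (owner G) i (mirror_map G x))
        (- ((1 / (alpha G * eta G)) *\<^sub>R (v + alpha G *\<^sub>R block (owner G) i e)))"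
      using ae by (intro ereal_0_le_mult fenchel_coupling_nonneg inS) simp
    show "fenchel_conj (strategies G i) (own_cost G i (mirror_map G (x + e))) (- u) \<noteq> -\<infinity>"
      by (rule fenchel_conj_neq_MInf[OF inS])
  qed (simp add: inner_diff_left inner_diff_right inner_commute)
qed

lemma convex_gameD:
  assumes "convex_game G" "y \<in> joint_strategies G"
  shows "C2_on (owner G) i (strategies G i) (own_cost G i y)"
    and "convex_on (strategies G i) (own_cost G i y)"
proof -
  have "\<forall>i. \<forall>y\<in>joint_strategies G. C2_on (owner G) i (strategies G i) (own_cost G i y) \<and>
          convex_on (strategies G i) (own_cost G i y)"
    using assms(1) unfolding convex_game_def by (elim conjE)
  from bspec[OF spec[OF this] assms(2)]
  show "C2_on (owner G) i (strategies G i) (own_cost G i y)"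
    and "convex_on (strategies G i) (own_cost G i y)"
    by (rule conjunct1, rule conjunct2)
qed

text \<open>Smoothness supplies some gradient; at an interior block it is the only one, hence the
  one selected by \<open>gradient_on\<close>.\<close>

lemma partial_gradient_has_gradient:
  assumes "convex_game G" "y \<in> joint_strategies G"
    and y: "block (owner G) i y \<in> block_interior (owner G) i (strategies G i)"
  shows "has_gradient_on (owner G) i (strategies G i) (own_cost G i y) (block (owner G) i y)
           (partial_gradient G i y)"
proof -
  obtain g where "has_gradient_on (owner G) i (strategies G i) (own_cost G i y) (block (owner G) i y) g"
    using convex_gameD(1)[OF assms(1,2), of i] block_interiorD[OF y] unfolding C2_on_def
    by (elim exE conjE) (drule (1) bspec, erule that)
  with gradient_on_eqI[OF y this] show ?thesis
    by (simp add: partial_gradient_def)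
qed

lemma hamiltonian_minimizer:
  assumes cg: "convex_game G" and mg: "mirror_geometry G" and gp: "game_parameters G"
    and min: "minimizes_hamiltonian G i (x, e) u v"
  shows "u = - partial_gradient G i (mirror_map G (x + e))"
    and "v = - (alpha G *\<^sub>R block (owner G) i e)
             - (alpha G * eta G) *\<^sub>R partial_gradient G i (mirror_map G x)"
proof -
  let ?S = "strategies G i" and ?B = "block_space (owner G) i"
  let ?yh = "mirror_map G (x + e)" and ?y = "mirror_map G x"
  let ?ae = "alpha G * eta G"
  \<comment> \<open>The dual argument of the second coupling, an invertible affine function of
    \<open>v\<close>.\<close>
  define dual where "dual v = - ((1 / ?ae) *\<^sub>R (v + alpha G *\<^sub>R block (owner G) i e))" for v
  define A where "A w = fenchel_coupling ?S (own_cost G i ?yh) (block (owner G) i ?yh) w" for w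
  define C where "C w = fenchel_coupling ?S (own_cost G i ?y) (block (owner G) i ?y) w" for w
  \<comment> \<open>Solution of \<open>dual v0 = partial_gradient G i ?y\<close>; it is the control
    law to be proved and serves as competitor.\<close>
  define v0 where "v0 = - (alpha G *\<^sub>R block (owner G) i e) - ?ae *\<^sub>R partial_gradient G i ?y"
  have ae: "?ae > 0" "alpha G > 0" "eta G > 0"
    using gp by (auto simp: game_parameters_def)
  have u: "u \<in> ?B" and v: "v \<in> ?B"
    using min by (auto simp: minimizes_hamiltonian_def)
  have int: "block (owner G) i (mirror_map G q) \<in> block_interior (owner G) i ?S" for q
    by (rule block_mirror_map_interior[OF mg])
  then have inS: "block (owner G) i (mirror_map G q) \<in> ?S" for q
    by (rule block_interiorD)
  have gr: "has_gradient_on (owner G) i ?S (own_cost G i (mirror_map G q))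
      (block (owner G) i (mirror_map G q)) (partial_gradient G i (mirror_map G q))" for q
    by (rule partial_gradient_has_gradient[OF cg mirror_map_in_joint_strategies[OF mg] int])
  have cvx: "convex_on ?S (own_cost G i (mirror_map G q))" for q
    by (rule convex_gameD(2)[OF cg mirror_map_in_joint_strategies[OF mg]])
  have pg: "partial_gradient G i (mirror_map G q) \<in> ?B" for q
    using gr by (auto simp: has_gradient_on_def)
  have H: "control_hamiltonian G i (x, e) u' v' = A (- u') + ereal ?ae * C (dual v')"
    if "u' \<in> ?B" "v' \<in> ?B" for u' v'
    unfolding A_def C_def dual_def by (rule control_hamiltonian_eq[OF mg gp that])
  have unique: "w = partial_gradient G i (mirror_map G q)"
    if "w \<in> ?B" "fenchel_coupling ?S (own_cost G i (mirror_map G q)) (block (owner G) i (mirror_map G q)) w \<le> 0" for w q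
    using that by (intro interior_minimum_gradient[OF int gr]) (auto simp: fenchel_coupling_le_0_iff inS)
  have v0: "v0 \<in> ?B" and u0: "- partial_gradient G i ?yh \<in> ?B"
    by (auto simp: v0_def intro!: subspace_diff subspace_neg subspace_scale subspace_block_space pg)
  have dual_v0: "dual v0 = partial_gradient G i ?y"
    using ae by (simp add: dual_def v0_def)
  have "A (- u) + ereal ?ae * C (dual v) \<le> A (- (- partial_gradient G i ?yh)) + ereal ?ae * C (dual v0)"
    using min u0 v0 unfolding minimizes_hamiltonian_def by (metis H)
  also have "\<dots> = 0"
    by (simp add: dual_v0 A_def C_def fenchel_coupling_gradient[OF cvx gr inS])
  finally have le: "A (- u) + ereal ?ae * C (dual v) \<le> 0" .
  have nonneg: "A (- u) \<ge> 0" "ereal ?ae * C (dual v) \<ge> 0"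
    using ae by (simp_all add: A_def C_def fenchel_coupling_nonneg inS)
  \<comment> \<open>Each summand is at most the sum because the other one is nonnegative.\<close>
  have le0: "A (- u) \<le> 0" "ereal ?ae * C (dual v) \<le> 0"
    by (rule order.trans[OF add_increasing2[OF nonneg(2) order.refl] le],
        rule order.trans[OF add_increasing[OF nonneg(1) order.refl] le])
  have C_le0: "C (dual v) \<le> 0"
    using le0(2) ae by (cases "C (dual v)") (auto simp: mult_le_0_iff)
  have "- u = partial_gradient G i ?yh"
    using le0(1) u unfolding A_def by (intro unique subspace_neg subspace_block_space)
  then show "u = - partial_gradient G i ?yh"
    by (metis minus_minus)
  have "dual v \<in> ?B"
    using v by (auto simp: dual_def intro!: subspace_add subspace_neg subspace_scale subspace_block_space)
  then have "dual v = partial_gradient G i ?y"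
    using C_le0 unfolding C_def by (intro unique)
  then have "?ae *\<^sub>R partial_gradient G i ?y = ?ae *\<^sub>R dual v"
    by simp
  also have "\<dots> = - (v + alpha G *\<^sub>R block (owner G) i e)"
    using ae by (simp add: dual_def)
  finally have "?ae *\<^sub>R partial_gradient G i ?y = - (v + alpha G *\<^sub>R block (owner G) i e)" .
  then show "v = - (alpha G *\<^sub>R block (owner G) i e) - ?ae *\<^sub>R partial_gradient G i ?y"
    by simp
qed

section \<open>The equilibrium trajectory\<close>

text \<open>The drift enters only through pathwise integrals over subintervals of
  \<open>{0..T}\<close>, so the stochastic integral \<open>I\<close> is kept. The exceptional null
  set in \<open>eq\<close> does not depend on the time.\<close>

lemma ito_equation_cong_drift:
  assumes eq: "AE \<omega> in M. \<forall>t\<in>{0..T}. b t \<omega> = b' t \<omega>"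
    and "ito_equation M F T W X b H"
  shows "ito_equation M F T W X b' H"
proof -
  obtain I where cont: "continuous_adapted M F T X"
    and int: "AE \<omega> in M. set_integrable lborel {0..T} (\<lambda>s. b s \<omega>)"
    and I: "has_ito_integral M F T W H I"
    and path: "AE \<omega> in M. \<forall>t\<in>{0..T}.
      X t \<omega> = X 0 \<omega> + set_lebesgue_integral lborel {0..t} (\<lambda>s. b s \<omega>) + I t \<omega>"
    using assms(2) unfolding ito_equation_def by blast
  have "AE \<omega> in M. set_integrable lborel {0..T} (\<lambda>s. b' s \<omega>)"
    using eq int
  proof eventually_elim
    case (elim \<omega>)
    then show ?case
      by (subst set_integrable_cong[where f' = "\<lambda>s. b s \<omega>"]) auto
  qed
  moreover have "AE \<omega> in M. \<forall>t\<in>{0..T}.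
      X t \<omega> = X 0 \<omega> + set_lebesgue_integral lborel {0..t} (\<lambda>s. b' s \<omega>) + I t \<omega>"
    using eq path
  proof eventually_elim
    case (elim \<omega>)
    have "set_lebesgue_integral lborel {0..t} (\<lambda>s. b s \<omega>) = set_lebesgue_integral lborel {0..t} (\<lambda>s. b' s \<omega>)"
      if "t \<in> {0..T}" for t
      using elim(1) that by (intro set_lebesgue_integral_cong) auto
    with elim(2) show ?case by metis
  qed
  ultimately show ?thesis
    using cont I unfolding ito_equation_def by blast
qed

text \<open>Coordinate \<open>k\<close> is read off from the block of its owner. The two
  coefficients cover both laws: \<open>c = 0\<close> for \<open>U\<close>, which has no linear term,
  and \<open>c = - alpha G\<close> for \<open>V\<close>.\<close>

lemma eq_col_of_blocks:
  assumes "\<And>i. block own i x = c *\<^sub>R block own i y + d *\<^sub>R f i"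
  shows "x = c *\<^sub>R y + d *\<^sub>R col own f"
proof -
  have "x $ k = (c *\<^sub>R y + d *\<^sub>R col own f) $ k" for k
    using arg_cong[OF assms[of "own k"], of "\<lambda>a. a $ k"] by (simp add: block_def col_def)
  then show ?thesis
    by (simp add: vec_eq_iff)
qed

theorem theorem1:
  fixes G :: "('i::finite, 'n::finite, 'w::finite, 'v::finite) mirror_game"
    and M :: "'p measure" and F :: "real \<Rightarrow> 'p measure"
    and W :: "real \<Rightarrow> 'p \<Rightarrow> real ^ 'w" and W' :: "real \<Rightarrow> 'p \<Rightarrow> real ^ 'v"
    and U V :: "real \<Rightarrow> (real ^ 'n) \<times> (real ^ 'n) \<Rightarrow> real ^ 'n"
    and z :: "(real ^ 'n) \<times> (real ^ 'n)"
    and X E :: "real \<Rightarrow> 'p \<Rightarrow> real ^ 'n"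
  assumes "convex_game G" and "mirror_geometry G" and "game_parameters G"
    and "stochastic_basis G M F W W'"
    and "closed_loop_equilibrium G M F W W' U V"
    and "closed_loop_trajectory G M F W W' U V z X E"
    and "AE \<omega> in M. \<forall>t\<in>{0..horizon G}. \<forall>i.
           minimizes_hamiltonian G i (X t \<omega>, E t \<omega>)
             (block (owner G) i (U t (X t \<omega>, E t \<omega>)))
             (block (owner G) i (V t (X t \<omega>, E t \<omega>)))"
  shows "(AE \<omega> in M. \<forall>t\<in>{0..horizon G}. \<forall>i.
            block (owner G) i (U t (X t \<omega>, E t \<omega>))
              = - partial_gradient G i (mirror_map G (X t \<omega> + E t \<omega>)) \<and>
            block (owner G) i (V t (X t \<omega>, E t \<omega>))
              = - (alpha G *\<^sub>R block (owner G) i (E t \<omega>))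
                - (alpha G * eta G) *\<^sub>R partial_gradient G i (mirror_map G (X t \<omega>)))
       \<and> ito_equation M F (horizon G) W X
            (\<lambda>t \<omega>. - pseudo_gradient G (mirror_map G (X t \<omega> + E t \<omega>)))
            (\<lambda>t \<omega>. diffusion G (X t \<omega>, E t \<omega>))
       \<and> ito_equation M F (horizon G) W' E
            (\<lambda>t \<omega>. - (alpha G *\<^sub>R E t \<omega>)
                    - (alpha G * eta G) *\<^sub>R pseudo_gradient G (mirror_map G (X t \<omega>)))
            (\<lambda>t \<omega>. aux_diffusion G (X t \<omega>, E t \<omega>))"
proof -
  \<comment> \<open>Minimality is assumed at every time and for every player outside one null set,
    so the pointwise result transfers with the same null set.\<close>
  have ctrl: "AE \<omega> in M. \<forall>t\<in>{0..horizon G}. \<forall>i.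
            block (owner G) i (U t (X t \<omega>, E t \<omega>))
              = - partial_gradient G i (mirror_map G (X t \<omega> + E t \<omega>)) \<and>
            block (owner G) i (V t (X t \<omega>, E t \<omega>))
              = - (alpha G *\<^sub>R block (owner G) i (E t \<omega>))
                - (alpha G * eta G) *\<^sub>R partial_gradient G i (mirror_map G (X t \<omega>))"
    using assms(7) by eventually_elim (use hamiltonian_minimizer[OF assms(1-3)] in blast)
  have drift_U: "AE \<omega> in M. \<forall>t\<in>{0..horizon G}.
      U t (X t \<omega>, E t \<omega>) = - pseudo_gradient G (mirror_map G (X t \<omega> + E t \<omega>))"
    using ctrl
  proof eventually_elim
    case (elim \<omega>)
    show ?case
    proof
      fix t assume "t \<in> {0..horizon G}"
      with elim show "U t (X t \<omega>, E t \<omega>) = - pseudo_gradient G (mirror_map G (X t \<omega> + E t \<omega>))"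
        using eq_col_of_blocks[where c = 0 and d = "-1" and own = "owner G"]
        by (simp add: pseudo_gradient_def)
    qed
  qed
  have drift_V: "AE \<omega> in M. \<forall>t\<in>{0..horizon G}.
      V t (X t \<omega>, E t \<omega>) = - (alpha G *\<^sub>R E t \<omega>)
        - (alpha G * eta G) *\<^sub>R pseudo_gradient G (mirror_map G (X t \<omega>))"
    using ctrl
  proof eventually_elim
    case (elim \<omega>)
    show ?case
    proof
      fix t assume "t \<in> {0..horizon G}"
      with elim show "V t (X t \<omega>, E t \<omega>) = - (alpha G *\<^sub>R E t \<omega>)
        - (alpha G * eta G) *\<^sub>R pseudo_gradient G (mirror_map G (X t \<omega>))"
        using eq_col_of_blocks[where c = "- alpha G" and d = "- (alpha G * eta G)" and own = "owner G"]
        by (simp add: pseudo_gradient_def)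
    qed
  qed
  \<comment> \<open>The closed-loop equations hold with the feedback controls as drifts; only these
    drifts are then replaced.\<close>
  have "ito_equation M F (horizon G) W X
      (\<lambda>t \<omega>. U t (X t \<omega>, E t \<omega>)) (\<lambda>t \<omega>. diffusion G (X t \<omega>, E t \<omega>))"
    and "ito_equation M F (horizon G) W' E
      (\<lambda>t \<omega>. V t (X t \<omega>, E t \<omega>)) (\<lambda>t \<omega>. aux_diffusion G (X t \<omega>, E t \<omega>))"
    using assms(6) by (simp_all add: closed_loop_trajectory_def)
  then show ?thesis
    by (intro conjI ctrl ito_equation_cong_drift[OF drift_U] ito_equation_cong_drift[OF drift_V])
qed

end
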